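(* Let $I\subset\mathbb{R}$ be a bounded interval containing the origin, let $\phi\in C^\infty(I,\mathbb{R})$ satisfy $\phi(0)\ne0$ and $\phi'(0)\neq0$, let $\eta\in C_0^\infty(\mathbb{R})$, not identically zero, be supported in a sufficiently small neighborhood of the origin, and let $$\mathcal{M}f(y):=\sup_{t\in[1,2]}\left|\int_{\mathbb{R}}f\big(y_1-tx,\;y_2-t^2x^2\phi(x)\big)\,\eta(x)\,dx\right|,\qquad y\in\mathbb{R}^2.$$ Let $p,q\in[1,\infty]$ and suppose there is a constant $C_{p,q}$ such that $\|\mathcal{M}f\|_{L^q(\mathbb{R}^2)}\le C_{p,q}\|f\|_{L^p(\mathbb{R}^2)}$ for all $f\in C_0^\infty(\mathbb{R}^2)$. Then all three of the following conditions hold: $(C1^\star)$ $\frac1q\le\frac1p$; $(C2^\star)$ $\frac1q\ge\frac1{2p}$; $(C3^\star)$ $\frac1q\ge\frac2p-1$.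
   Context: The convention $1/\infty=0$ is used. *)

theory Defs
  imports "HOL-Analysis.Analysis" "HOL-Probability.Essential_Supremum"
begin

text \<open>
  Derivatives are taken within \<open>S\<close>, so they are one-sided at those endpoints of an interval
  that belong to it. The definition is meant for sets \<open>S\<close> on which the derivative within \<open>S\<close>
  is unique: open sets and nondegenerate intervals.
\<close>

primrec Ck_on :: "nat \<Rightarrow> ('a::real_normed_vector \<Rightarrow> 'b::real_normed_vector) \<Rightarrow> 'a set \<Rightarrow> bool"
where
  "Ck_on 0 f S \<longleftrightarrow> continuous_on S f"
| "Ck_on (Suc k) f S \<longleftrightarrow>
     f differentiable_on S \<and> (\<forall>v. Ck_on k (\<lambda>x. frechet_derivative f (at x within S) v) S)"

definition Cinf_on :: "('a::real_normed_vector \<Rightarrow> 'b::real_normed_vector) \<Rightarrow> 'a set \<Rightarrow> bool"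
  where "Cinf_on f S \<longleftrightarrow> (\<forall>k. Ck_on k f S)"

definition supp :: "('a::topological_space \<Rightarrow> 'b::zero) \<Rightarrow> 'a set"
  where "supp f = closure {x. f x \<noteq> 0}"

definition C0inf :: "('a::real_normed_vector \<Rightarrow> 'b::real_normed_vector) \<Rightarrow> bool"
  where "C0inf f \<longleftrightarrow> Cinf_on f UNIV \<and> compact (supp f)"

text \<open>Real powers on \<^typ>\<open>ennreal\<close>, used only for positive exponents.\<close>

definition ennpowr :: "ennreal \<Rightarrow> real \<Rightarrow> ennreal"
  where "ennpowr u a = (if u = \<infinity> then \<infinity> else ennreal (enn2real u powr a))"

text \<open>
  The \<open>L\<^sup>p\<close> norm, \<open>1 \<le> p \<le> \<infinity>\<close>, of a function given through its modulus.
\<close>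

definition Lp_norm :: "ereal \<Rightarrow> 'a measure \<Rightarrow> ('a \<Rightarrow> ennreal) \<Rightarrow> ennreal"
  where "Lp_norm p M g =
    (if p = \<infinity> then esssup M g
     else ennpowr (\<integral>\<^sup>+ x. ennpowr (g x) (real_of_ereal p) \<partial>M) (1 / real_of_ereal p))"

definition maximal_fun ::
  "(real \<Rightarrow> real) \<Rightarrow> (real \<Rightarrow> complex) \<Rightarrow> (real \<times> real \<Rightarrow> complex) \<Rightarrow> real \<times> real \<Rightarrow> ennreal"
  where "maximal_fun \<phi> \<eta> f y =
    (SUP t\<in>{1..2}.
       ennreal (norm (LINT x|lborel. f (fst y - t * x, snd y - t\<^sup>2 * x\<^sup>2 * \<phi> x) * \<eta> x)))"

end

theory Submission
  imports Defs
begin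

text \<open>
  The necessary conditions come from testing the inequality on smooth versions of indicator
  functions. Write \<open>a = 1 / q\<close> and \<open>b = 1 / p\<close>, and let \<open>x0 \<noteq> 0\<close> be a point with \<open>\<eta> x0 \<noteq> 0\<close>. All test
  functions are nonnegative and arranged so that, for the relevant \<open>y\<close> and \<open>t\<close>, only parameters \<open>x\<close>
  near \<open>x0\<close> contribute to the integral. There the phase of \<open>\<eta>\<close> is almost constant, so cancellation
  is excluded although \<open>\<eta>\<close> is complex and may vanish at the origin.

  Since \<open>\<phi>' 0 \<noteq> 0\<close>, the function \<open>\<phi>\<close> is injective near the origin, and the dilated curves
  \<open>(t * x, t\<^sup>2 * x\<^sup>2 * \<phi> x)\<close> with \<open>x\<close> near \<open>x0\<close> and \<open>1 \<le> t \<le> 2\<close> sweep out a whole rectangle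
  (\<open>swept_rectangle\<close>). If \<open>f\<close> is a bump on a square of side \<open>\<epsilon>\<close>, then the maximal function is at
  least a constant times \<open>\<epsilon>\<close> on a translate of that rectangle. If \<open>f\<close> consists of \<open>N\<close> far apart
  copies of such a bump, then this happens on \<open>N\<close> disjoint translates (\<open>translated_boxes\<close>), and
  the assumed bound gives
  \<open>\<epsilon> * N powr a \<le> const * (\<epsilon>\<^sup>2 * N) powr b\<close>.
  Letting \<open>N\<close> grow proves \<open>a \<le> b\<close>. Letting \<open>\<epsilon>\<close> shrink proves \<open>b \<le> 1 / 2\<close>. This is stronger than
  the third condition, because then \<open>2 * b - 1 \<le> 0 \<le> a\<close>.

  If instead \<open>f\<close> is a bump on an \<open>\<epsilon>\<close>-neighbourhood of the reflected curve, then the maximal function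
  is bounded below by a constant on a square of side \<open>\<epsilon>\<close> around the origin (\<open>tiled_curve\<close>). Hence
  \<open>\<epsilon> powr (2 * a) \<le> const * \<epsilon> powr b\<close>, and \<open>\<epsilon> \<rightarrow> 0\<close> proves \<open>b \<le> 2 * a\<close>, the second condition. The
  neighbourhood is covered by small squares, so that smoothness of \<open>f\<close> comes from one explicit bump
  (\<open>ex_smooth_union_boxes\<close>) and of the curve only a Lipschitz bound enters.
\<close>

section \<open>A smooth algebra of bump functions\<close>

text \<open>
  Differentiating \<open>exp (- 1 / x)\<close> produces factors that are polynomials in \<open>1 / x\<close>. Carrying
  such a factor \<open>P\<close> along makes the family closed under differentiation.
\<close>

definition flat :: "real poly \<Rightarrow> real \<Rightarrow> real"
  where "flat P x = (if x > 0 then poly P (1 / x) * exp (- (1 / x)) else 0)"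

lemma poly_div_exp_tendsto_0: "((\<lambda>u::real. poly P u * exp (- u)) \<longlongrightarrow> 0) at_top"
proof -
  have "((\<lambda>u::real. \<Sum>i\<le>degree P. coeff P i * (u ^ i / exp u)) \<longlongrightarrow> (\<Sum>i\<le>degree P. coeff P i * 0)) at_top"
    by (intro tendsto_sum tendsto_mult tendsto_const tendsto_power_div_exp_0)
  then show ?thesis
    by (simp add: poly_altdef sum_distrib_right exp_minus divide_inverse mult.assoc)
qed

text \<open>
  The only delicate point is the origin: there the difference quotient is, with \<open>u = 1 / h\<close>, a
  polynomial in \<open>u\<close> times \<open>exp (- u)\<close>, and it tends to \<open>0\<close> as \<open>u\<close> tends to infinity.
\<close>

lemma flat_has_real_derivative:
  "(flat P has_real_derivative flat (monom 1 2 * (P - pderiv P)) x) (at x)"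
proof -
  consider "x > 0" | "x < 0" | "x = 0" by linarith
  then show ?thesis
  proof cases
    case 1
    have "((\<lambda>x. poly P (1 / x) * exp (- (1 / x))) has_real_derivative
        flat (monom 1 2 * (P - pderiv P)) x) (at x)"
      using 1
      by (auto intro!: derivative_eq_intros poly_DERIV[THEN DERIV_chain2]
          simp: flat_def poly_monom power2_eq_square algebra_simps)
    then show ?thesis
      by (rule has_field_derivative_transform_within_open[where S="{0<..}"])
        (use 1 in \<open>auto simp: flat_def\<close>)
  next
    case 2
    have "((\<lambda>x. 0) has_real_derivative flat (monom 1 2 * (P - pderiv P)) x) (at x)"
      using 2 by (auto simp: flat_def)
    then show ?thesis
      by (rule has_field_derivative_transform_within_open[where S="{..<0}"])
        (use 2 in \<open>auto simp: flat_def\<close>)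
  next
    case 3
    have "((\<lambda>h. flat P h / h) \<longlongrightarrow> 0) (at_right 0)"
    proof (subst filterlim_at_right_to_top)
      have "((\<lambda>u. poly (pCons 0 P) u * exp (- u)) \<longlongrightarrow> 0) at_top"
        by (rule poly_div_exp_tendsto_0)
      then show "((\<lambda>u. flat P (inverse u) / inverse u) \<longlongrightarrow> 0) at_top"
        by (rule Lim_transform_eventually)
          (use eventually_gt_at_top[of "0::real"] in eventually_elim,
            auto simp: flat_def field_simps)
    qed
    moreover have "((\<lambda>h. flat P h / h) \<longlongrightarrow> 0) (at_left 0)"
      by (rule Lim_transform_eventually[OF tendsto_const])
        (auto simp: flat_def eventually_at_filter)
    ultimately have "((\<lambda>h. flat P h / h) \<longlongrightarrow> 0) (at 0)"
      by (simp add: filterlim_split_at)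
    with 3 show ?thesis by (simp add: DERIV_def flat_def)
  qed
qed

text \<open>
  A syntactically generated class of functions that contains the test functions below and whose
  directional derivatives belong to the class again. This closure yields smoothness of all orders
  at once, without a product or chain rule for \<^const>\<open>Ck_on\<close>.
\<close>

inductive smooth_algebra :: "('a::real_normed_vector \<Rightarrow> real) \<Rightarrow> bool"
  where
    linear: "bounded_linear f \<Longrightarrow> smooth_algebra f"
  | const: "smooth_algebra (\<lambda>_. c)"
  | add: "smooth_algebra f \<Longrightarrow> smooth_algebra g \<Longrightarrow> smooth_algebra (\<lambda>x. f x + g x)"
  | mult: "smooth_algebra f \<Longrightarrow> smooth_algebra g \<Longrightarrow> smooth_algebra (\<lambda>x. f x * g x)"
  | flat: "smooth_algebra f \<Longrightarrow> smooth_algebra (\<lambda>x. flat P (f x))"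

lemma smooth_algebra_derivative:
  assumes "smooth_algebra f"
  shows "\<exists>f'. (\<forall>x. (f has_derivative f' x) (at x)) \<and> (\<forall>v. smooth_algebra (\<lambda>x. f' x v))"
  using assms
proof induction
  case (linear f)
  then show ?case
    by (intro exI[of _ "\<lambda>x. f"]) (auto intro: smooth_algebra.const bounded_linear_imp_has_derivative)
next
  case (const c)
  then show ?case
    by (intro exI[of _ "\<lambda>x v. 0"]) (auto intro: smooth_algebra.const)
next
  case (add f g)
  then obtain f' g' where
    "\<And>x. (f has_derivative f' x) (at x)" "\<And>v. smooth_algebra (\<lambda>x. f' x v)"
    "\<And>x. (g has_derivative g' x) (at x)" "\<And>v. smooth_algebra (\<lambda>x. g' x v)" by blast
  then show ?case
    by (intro exI[of _ "\<lambda>x v. f' x v + g' x v"]) (auto intro: smooth_algebra.add has_derivative_add)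
next
  case (mult f g)
  then obtain f' g' where
    "\<And>x. (f has_derivative f' x) (at x)" "\<And>v. smooth_algebra (\<lambda>x. f' x v)"
    "\<And>x. (g has_derivative g' x) (at x)" "\<And>v. smooth_algebra (\<lambda>x. g' x v)" by blast
  with mult.hyps show ?case
    by (intro exI[of _ "\<lambda>x v. f x * g' x v + f' x v * g x"])
      (auto intro!: smooth_algebra.add smooth_algebra.mult has_derivative_mult)
next
  case (flat f P)
  then obtain f' where f': "\<And>x. (f has_derivative f' x) (at x)" "\<And>v. smooth_algebra (\<lambda>x. f' x v)"
    by blast
  let ?Q = "monom 1 2 * (P - pderiv P)"
  have "((\<lambda>x. flat P (f x)) has_derivative (\<lambda>v. flat ?Q (f x) * f' x v)) (at x)" for x
    using has_derivative_compose[OF f'(1)[of x]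
        flat_has_real_derivative[of P "f x", unfolded has_field_derivative_def]]
    by simp
  with flat.hyps f' show ?case
    by (intro exI[of _ "\<lambda>x v. flat ?Q (f x) * f' x v"])
      (auto intro!: smooth_algebra.mult smooth_algebra.flat)
qed

lemma smooth_algebra_isCont: "smooth_algebra f \<Longrightarrow> isCont f x"
  using smooth_algebra_derivative has_derivative_continuous by blast

lemma smooth_algebra_Cinf_on:
  assumes "smooth_algebra f"
  shows "Cinf_on (\<lambda>x. complex_of_real (f x)) UNIV"
proof -
  have "Ck_on k (\<lambda>x. complex_of_real (f x)) UNIV" for k
    using assms
  proof (induction k arbitrary: f)
    case 0
    then show ?case
      by (auto intro!: continuous_at_imp_continuous_on continuous_of_real smooth_algebra_isCont
          simp: continuous_at_imp_continuous_on)
  next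
    case (Suc k)
    obtain f' where f': "\<And>x. (f has_derivative f' x) (at x)" "\<And>v. smooth_algebra (\<lambda>x. f' x v)"
      using smooth_algebra_derivative[OF Suc.prems] by blast
    have D: "((\<lambda>x. complex_of_real (f x)) has_derivative (\<lambda>v. complex_of_real (f' x v))) (at x)" for x
      using f'(1) by (rule has_derivative_of_real)
    then have "frechet_derivative (\<lambda>x. complex_of_real (f x)) (at x) = (\<lambda>v. complex_of_real (f' x v))" for x
      by (metis frechet_derivative_at)
    with D Suc.IH[OF f'(2)] show ?case
      by (auto simp: differentiable_on_def differentiable_def)
  qed
  then show ?thesis by (simp add: Cinf_on_def)
qed

lemma smooth_algebra_diff: "smooth_algebra f \<Longrightarrow> smooth_algebra g \<Longrightarrow> smooth_algebra (\<lambda>x. f x - g x)"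
  using smooth_algebra.add[of f "\<lambda>x. - 1 * g x"] smooth_algebra.mult smooth_algebra.const by fastforce

lemma smooth_algebra_prod:
  "finite A \<Longrightarrow> (\<And>c. c \<in> A \<Longrightarrow> smooth_algebra (F c)) \<Longrightarrow> smooth_algebra (\<lambda>x. \<Prod>c\<in>A. F c x)"
  by (induction A rule: finite_induct) (auto intro: smooth_algebra.const smooth_algebra.mult)

text \<open>
  Indicator functions need only be matched up to constants, so a positive lower bound on \<open>[-1, 1]\<close>
  replaces the value \<open>1\<close> there. This avoids the normalizing quotient of the usual cutoff functions.
\<close>

definition bump :: "real \<Rightarrow> real"
  where "bump s = flat 1 (2 - s) * flat 1 (2 + s)"

lemma flat_1_bounds: "0 \<le> flat 1 x" "flat 1 x \<le> 1" "1 \<le> x \<Longrightarrow> exp (- 1) \<le> flat 1 x"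
  by (auto simp: flat_def)

lemma bump_bounds: "0 \<le> bump s" "bump s \<le> 1"
  using flat_1_bounds by (auto simp: bump_def intro: mult_le_one)

lemma bump_eq_0: "2 < \<bar>s\<bar> \<Longrightarrow> bump s = 0"
  by (auto simp: bump_def flat_def)

lemma bump_ge: "\<bar>s\<bar> \<le> 1 \<Longrightarrow> exp (- 2) \<le> bump s"
proof -
  assume "\<bar>s\<bar> \<le> 1"
  then have "exp (- 1) * exp (- 1) \<le> bump s"
    unfolding bump_def by (intro mult_mono flat_1_bounds) auto
  then show ?thesis by (simp flip: exp_add)
qed

text \<open>
  Write \<open>F c\<close> for the product bump adapted to the square around \<open>c\<close>. The function
  \<open>1 - (\<Prod>c\<in>Z. 1 - F c)\<close> dominates every \<open>F c\<close>, yet it is at most \<open>1\<close> however much the squares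
  overlap. Therefore its \<open>L\<^sup>p\<close> norm is controlled by the total area of the squares alone.
\<close>

lemma ex_smooth_union_boxes:
  fixes Z :: "(real \<times> real) set"
  assumes "finite Z" "\<epsilon> > 0"
  obtains f :: "real \<times> real \<Rightarrow> real" where
    "C0inf (\<lambda>z. complex_of_real (f z))" "continuous_on UNIV f" "\<And>z. 0 \<le> f z" "\<And>z. f z \<le> 1"
    "\<And>z. f z \<noteq> 0 \<Longrightarrow> \<exists>c\<in>Z. \<bar>fst z - fst c\<bar> \<le> 2 * \<epsilon> \<and> \<bar>snd z - snd c\<bar> \<le> 2 * \<epsilon>"
    "\<And>z c. c \<in> Z \<Longrightarrow> \<bar>fst z - fst c\<bar> \<le> \<epsilon> \<Longrightarrow> \<bar>snd z - snd c\<bar> \<le> \<epsilon> \<Longrightarrow> exp (- 4) \<le> f z"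
proof -
  define F where "F c z = bump ((fst z - fst c) / \<epsilon>) * bump ((snd z - snd c) / \<epsilon>)" for c z :: "real \<times> real"
  define f where "f z = 1 - (\<Prod>c\<in>Z. 1 - F c z)" for z
  have F01: "0 \<le> F c z" "F c z \<le> 1" for c z
    using bump_bounds by (auto simp: F_def intro: mult_le_one)
  have lin: "smooth_algebra (\<lambda>z::real \<times> real. (fst z - c) / \<epsilon>)"
    "smooth_algebra (\<lambda>z::real \<times> real. (snd z - c) / \<epsilon>)" for c
    unfolding divide_inverse
    by (intro smooth_algebra.mult smooth_algebra.const smooth_algebra_diff
        smooth_algebra.linear bounded_linear_fst bounded_linear_snd)+
  have smF: "smooth_algebra (F c)" for c
    unfolding F_def bump_def
    by (intro smooth_algebra.mult smooth_algebra.flat smooth_algebra_diff smooth_algebra.add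
        smooth_algebra.const lin)
  have sm: "smooth_algebra f"
    unfolding f_def by (intro smooth_algebra_diff smooth_algebra.const smooth_algebra_prod assms smF)
  have "0 \<le> (\<Prod>c\<in>Z. 1 - F c z)" "(\<Prod>c\<in>Z. 1 - F c z) \<le> 1" for z
    using F01 by (simp_all add: prod_nonneg prod_le_1)
  then have f01: "0 \<le> f z" "f z \<le> 1" for z
    by (simp_all add: f_def)
  have f0: "\<exists>c\<in>Z. \<bar>fst z - fst c\<bar> \<le> 2 * \<epsilon> \<and> \<bar>snd z - snd c\<bar> \<le> 2 * \<epsilon>" if "f z \<noteq> 0" for z
  proof -
    have "f z = 0" if "\<forall>c\<in>Z. F c z = 0"
      using that by (simp add: f_def)
    with that obtain c where c: "c \<in> Z" "F c z \<noteq> 0" by blast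
    then have "\<not> 2 < \<bar>(fst z - fst c) / \<epsilon>\<bar>" "\<not> 2 < \<bar>(snd z - snd c) / \<epsilon>\<bar>"
      using bump_eq_0 by (auto simp: F_def)
    with c(1) assms(2) show ?thesis
      by (auto simp: abs_divide field_simps intro!: bexI[of _ c])
  qed
  have ge: "exp (- 4) \<le> f z"
    if c: "c \<in> Z" "\<bar>fst z - fst c\<bar> \<le> \<epsilon>" "\<bar>snd z - snd c\<bar> \<le> \<epsilon>" for z c
  proof -
    have "exp (- 2) * exp (- 2) \<le> F c z"
      unfolding F_def using c assms(2) bump_bounds by (intro mult_mono bump_ge) auto
    then have "exp (- 4) \<le> F c z" by (simp flip: exp_add)
    moreover have "(\<Prod>c\<in>Z. 1 - F c z) \<le> 1 - F c z"
    proof -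
      have "(\<Prod>c\<in>Z - {c}. 1 - F c z) \<le> 1" using F01 by (intro prod_le_1) auto
      moreover have "(\<Prod>c\<in>Z. 1 - F c z) = (1 - F c z) * (\<Prod>c\<in>Z - {c}. 1 - F c z)"
        using c(1) assms(1) by (rule prod.remove[rotated])
      ultimately show ?thesis using F01[of c z] by (simp add: mult_left_le)
    qed
    ultimately show ?thesis by (simp add: f_def)
  qed
  have "{z. f z \<noteq> 0} \<subseteq> (\<Union>c\<in>Z. {fst c - 2 * \<epsilon>..fst c + 2 * \<epsilon>} \<times> {snd c - 2 * \<epsilon>..snd c + 2 * \<epsilon>})"
    using f0 by (fastforce simp: abs_le_iff)
  then have "bounded {z. f z \<noteq> 0}"
    by (rule bounded_subset[rotated]) (auto intro!: bounded_UN assms bounded_Times)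
  then have "compact (supp (\<lambda>z. complex_of_real (f z)))"
    by (simp add: supp_def)
  then have "C0inf (\<lambda>z. complex_of_real (f z))"
    using smooth_algebra_Cinf_on[OF sm] by (simp add: C0inf_def)
  moreover have "continuous_on UNIV f"
    using smooth_algebra_isCont[OF sm] by (simp add: continuous_at_imp_continuous_on)
  ultimately show ?thesis using that f01 f0 ge by blast
qed

section \<open>Norms, exponents and integrals\<close>

lemma ennpowr_ennreal: "0 \<le> x \<Longrightarrow> ennpowr (ennreal x) a = ennreal (x powr a)"
  by (simp add: ennpowr_def)

lemma ennpowr_mono: "0 \<le> a \<Longrightarrow> x \<le> y \<Longrightarrow> ennpowr x a \<le> ennpowr y a"
  by (cases x; cases y) (auto simp: ennpowr_def top_unique intro!: ennreal_leI powr_mono2)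

text \<open>
  Since \<^term>\<open>real_of_ereal \<infinity> = 0\<close> and \<open>1 / 0 = 0\<close>, the expression \<open>1 / real_of_ereal q\<close> is the
  reciprocal exponent with the convention \<open>1 / \<infinity> = 0\<close>, so finite and infinite exponents share
  one formula. Monotonicity of the nonnegative integral holds for all functions, and the essential
  supremum of a nonmeasurable function is the top element; so the bound applies directly to a
  supremum over uncountably many \<open>t\<close>.
\<close>

lemma Lp_norm_ge_on:
  fixes q :: ereal
  assumes q: "1 \<le> q" and S: "S \<in> sets M" "emeasure M S = ennreal m" and m: "m > 0" and c: "c \<ge> 0"
    and ge: "\<And>x. x \<in> S \<Longrightarrow> ennreal c \<le> g x"
  shows "ennreal (c * m powr (1 / real_of_ereal q)) \<le> Lp_norm q M g"
proof (cases q)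
  case PInf
  have "ennreal c \<le> esssup M g"
  proof (rule ccontr)
    assume "\<not> ennreal c \<le> esssup M g"
    with esssup_AE[of g M] have "AE x in M. x \<notin> S"
      by (auto elim!: eventually_mono dest: ge)
    then have "emeasure M S = 0"
      using AE_iff_measurable[OF S(1), of "\<lambda>x. x \<notin> S"] sets.sets_into_space[OF S(1)]
      by blast
    with S m show False by simp
  qed
  with PInf m show ?thesis by (simp add: Lp_norm_def)
next
  case (real r)
  with q have r: "1 \<le> r" by (simp add: one_ereal_def)
  have "ennreal (c powr r * m) = (\<integral>\<^sup>+x. ennreal (c powr r) * indicator S x \<partial>M)"
    using S m by (simp add: nn_integral_cmult_indicator ennreal_mult)
  also have "\<dots> \<le> (\<integral>\<^sup>+x. ennpowr (g x) r \<partial>M)"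
  proof (rule nn_integral_mono)
    fix x
    show "ennreal (c powr r) * indicator S x \<le> ennpowr (g x) r"
      using ennpowr_mono[of r "ennreal c" "g x"] ge[of x] r c
      by (auto simp: ennpowr_ennreal indicator_def)
  qed
  finally have "ennpowr (ennreal (c powr r * m)) (1 / r) \<le> Lp_norm q M g"
    using r real by (auto simp: Lp_norm_def intro!: ennpowr_mono)
  moreover have "(c powr r * m) powr (1 / r) = c * m powr (1 / r)"
    using r c m by (simp add: powr_mult powr_powr)
  ultimately show ?thesis
    using m real by (simp add: ennpowr_ennreal)
qed (use q in auto)

lemma Lp_norm_le_of_support:
  fixes p :: ereal
  assumes p: "1 \<le> p" and g: "g \<in> borel_measurable M"
    and S: "S \<in> sets M" "emeasure M S \<le> ennreal m" and m: "m > 0"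
    and le: "\<And>x. g x \<le> 1" and out: "\<And>x. x \<notin> S \<Longrightarrow> g x = 0"
  shows "Lp_norm p M g \<le> ennreal (m powr (1 / real_of_ereal p))"
proof (cases p)
  case PInf
  have "esssup M g \<le> 1" using g le by (intro esssup_I) auto
  with PInf m show ?thesis by (simp add: Lp_norm_def)
next
  case (real r)
  with p have r: "1 \<le> r" by (simp add: one_ereal_def)
  have "(\<integral>\<^sup>+x. ennpowr (g x) r \<partial>M) \<le> (\<integral>\<^sup>+x. indicator S x \<partial>M)"
  proof (rule nn_integral_mono)
    fix x
    show "ennpowr (g x) r \<le> indicator S x"
      using ennpowr_mono[of r "g x" 1] le[of x] out[of x] r
        ennpowr_ennreal[of 1 r] ennpowr_ennreal[of 0 r]
      by (auto simp: indicator_def)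
  qed
  also have "\<dots> \<le> ennreal m" using S by simp
  finally have "Lp_norm p M g \<le> ennpowr (ennreal m) (1 / r)"
    using r real by (auto simp: Lp_norm_def intro!: ennpowr_mono)
  then show ?thesis using m real by (simp add: ennpowr_ennreal)
qed (use p in auto)

text \<open>
  Every necessary condition below is read off from a family of test functions by comparing powers
  of a parameter, which is a number of translates or the reciprocal of a scale.
\<close>

lemma exponent_le_of_power_bound:
  fixes X Y a b :: real
  assumes X: "X > 0" and bound: "\<And>n. n \<ge> n0 \<Longrightarrow> X * real n powr a \<le> Y * real n powr b"
  shows "a \<le> b"
proof (rule ccontr)
  assume "\<not> a \<le> b"
  then have "(\<lambda>n. real n powr (b - a)) \<longlonglongrightarrow> 0"
    by (intro tendsto_neg_powr filterlim_real_sequentially) auto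
  then have "(\<lambda>n. Y * real n powr (b - a)) \<longlonglongrightarrow> 0"
    by (rule tendsto_mult_right_zero)
  moreover have "X \<le> Y * real n powr (b - a)" if "n \<ge> max n0 1" for n
  proof -
    have "X * real n powr a \<le> (Y * real n powr (b - a)) * real n powr a"
      using bound[of n] that by (simp add: mult.assoc flip: powr_add)
    then show ?thesis by (rule mult_right_le_imp_le) (use that in auto)
  qed
  then have "\<forall>\<^sub>F n in sequentially. X \<le> Y * real n powr (b - a)"
    by (rule eventually_sequentiallyI)
  ultimately have "X \<le> 0"
    by (rule tendsto_lowerbound) simp
  with X show False by simp
qed

text \<open>
  Rotating by \<open>w\<close> turns the modulus of a complex integral into the integral of a nonnegative real
  part, so that no cancellation can occur.
\<close>

lemma norm_integral_ge:
  fixes G :: "real \<Rightarrow> complex"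
  assumes S: "compact S" "continuous_on S G" and out: "\<And>x. x \<notin> S \<Longrightarrow> G x = 0"
    and nonneg: "\<And>x. x \<in> S \<Longrightarrow> 0 \<le> Re (w * G x)"
    and ab: "a \<le> b" "{a..b} \<subseteq> S" and c: "\<And>x. x \<in> {a..b} \<Longrightarrow> c \<le> Re (w * G x)"
    and w: "norm w \<le> 1"
  shows "c * (b - a) \<le> norm (LINT x|lborel. G x)"
proof -
  have int: "integrable lborel G"
  proof -
    have "integrable lborel (\<lambda>x. indicator S x *\<^sub>R G x)"
      using S by (rule borel_integrable_compact)
    also have "(\<lambda>x. indicator S x *\<^sub>R G x) = G"
      using out by (auto simp: indicator_def)
    finally show ?thesis .
  qed
  have "c * (b - a) = (LINT x|lborel. c * indicator {a..b} x)"
    using ab by simp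
  also have "\<dots> \<le> (LINT x|lborel. Re (w * G x))"
  proof (rule integral_mono)
    show "integrable lborel (\<lambda>x. c * indicator {a..b} x)"
      by (intro integrable_mult_right) (simp add: integrable_indicator_iff emeasure_lborel_Icc_eq)
    show "integrable lborel (\<lambda>x. Re (w * G x))"
      using int by simp
    show "c * indicator {a..b} x \<le> Re (w * G x)" for x
      using c[of x] nonneg[of x] out[of x]
      by (cases "x \<in> {a..b}"; cases "x \<in> S") (auto simp: indicator_def)
  qed
  also have "\<dots> = Re (w * (LINT x|lborel. G x))"
    using int by simp
  also have "\<dots> \<le> norm w * norm (LINT x|lborel. G x)"
    by (metis complex_Re_le_cmod norm_mult)
  also have "\<dots> \<le> norm (LINT x|lborel. G x)"
    using w by (simp add: mult_left_le_one_le)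
  finally show ?thesis .
qed

lemma emeasure_rectangle:
  fixes a b c d :: real
  assumes "a \<le> b" "c \<le> d"
  shows "emeasure lborel ({a..b} \<times> {c..d}) = ennreal ((b - a) * (d - c))"
  using assms lborel.emeasure_pair_measure_Times[of "{a..b}" lborel "{c..d}"]
  by (simp add: lborel_prod ennreal_mult)

section \<open>Localization of the curve\<close>

text \<open>
  This is where the size of the support of \<open>\<eta>\<close> is decided. By continuity the derivative stays
  within \<open>\<bar>d\<bar> / 2\<close> of \<open>d = \<phi>' 0\<close> near the origin, and the mean value inequality applies to
  \<open>\<phi> x - d * x\<close>. The estimate says both that \<open>\<phi>\<close> is injective and that it is Lipschitz near \<open>0\<close>.
\<close>

lemma near_linear_of_nonzero_derivative:
  fixes \<phi> :: "real \<Rightarrow> real"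
  assumes I: "is_interval I" "interior I \<noteq> {}" "0 \<in> I" and \<phi>: "Cinf_on \<phi> I"
    and nz: "vector_derivative \<phi> (at 0 within I) \<noteq> 0"
  obtains \<delta> d where "0 < \<delta>" "\<delta> \<le> 1" "d \<noteq> 0"
    "\<And>x y. x \<in> I \<inter> {-\<delta><..<\<delta>} \<Longrightarrow> y \<in> I \<inter> {-\<delta><..<\<delta>} \<Longrightarrow>
      \<bar>\<phi> x - \<phi> y - d * (x - y)\<bar> \<le> \<bar>d\<bar> / 2 * \<bar>x - y\<bar>"
proof -
  define D where "D x = frechet_derivative \<phi> (at x within I) 1" for x
  have C1: "Ck_on (Suc 0) \<phi> I" using \<phi> unfolding Cinf_on_def by blast
  then have contD: "continuous_on I D" by (simp add: D_def)
  have der: "(\<phi> has_real_derivative D x) (at x within I)" if "x \<in> I" for x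
  proof -
    have "\<phi> differentiable (at x within I)"
      using C1 that by (simp add: differentiable_on_def)
    then have d: "(\<phi> has_derivative frechet_derivative \<phi> (at x within I)) (at x within I)"
      by (simp add: frechet_derivative_works)
    then obtain k where "frechet_derivative \<phi> (at x within I) = (\<lambda>h. h * k)"
      using has_derivative_bounded_linear real_bounded_linear by blast
    with d show ?thesis
      by (simp add: D_def has_field_derivative_def mult_commute_abs)
  qed
  \<comment> \<open>The origin may be an endpoint of \<open>I\<close>; the derivative within \<open>I\<close> is still unique there.\<close>
  have "D 0 \<noteq> 0"
  proof -
    have "\<nexists>a. I = {a}"
      using I(2) by auto
    then have "0 islimpt I"
      using connected_imp_perfect[of I 0] I is_interval_connected by blast
    then have "at 0 within I \<noteq> bot"
      by (simp add: trivial_limit_within)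
    then have "vector_derivative \<phi> (at 0 within I) = D 0"
      using der[OF I(3)] by (simp add: vector_derivative_within has_real_derivative_iff_has_vector_derivative)
    with nz show ?thesis by simp
  qed
  then obtain \<delta>0 where \<delta>0: "\<delta>0 > 0" "\<And>x. x \<in> I \<Longrightarrow> \<bar>x\<bar> < \<delta>0 \<Longrightarrow> \<bar>D x - D 0\<bar> < \<bar>D 0\<bar> / 2"
    using contD I(3) unfolding continuous_on_iff dist_real_def
    by (metis diff_zero half_gt_zero zero_less_abs_iff)
  define \<delta> where "\<delta> = min \<delta>0 1"
  let ?A = "I \<inter> {-\<delta><..<\<delta>}"
  show ?thesis
  proof
    fix x y assume xy: "x \<in> ?A" "y \<in> ?A"
    have "norm ((\<phi> x - D 0 * x) - (\<phi> y - D 0 * y)) \<le> \<bar>D 0\<bar> / 2 * norm (x - y)"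
    proof (rule field_differentiable_bound[of ?A])
      show "convex ?A"
        using I(1) by (intro convex_Int) (auto simp: is_interval_convex)
      show "((\<lambda>x. \<phi> x - D 0 * x) has_field_derivative D z - D 0) (at z within ?A)" if "z \<in> ?A" for z
        using that
        by (auto intro!: derivative_eq_intros DERIV_subset[OF der])
      show "norm (D z - D 0) \<le> \<bar>D 0\<bar> / 2" if "z \<in> ?A" for z
        using \<delta>0(2)[of z] that by (auto simp: \<delta>_def less_imp_le)
    qed (use xy in auto)
    then show "\<bar>\<phi> x - \<phi> y - D 0 * (x - y)\<bar> \<le> \<bar>D 0\<bar> / 2 * \<bar>x - y\<bar>"
      by (simp add: algebra_simps)
  qed (use \<delta>0 \<open>D 0 \<noteq> 0\<close> in \<open>auto simp: \<delta>_def\<close>)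
qed

section \<open>Test functions\<close>

lemma ex_test_function:
  fixes Z :: "(real \<times> real) set"
  assumes Z: "finite Z" and \<epsilon>: "\<epsilon> > 0"
  obtains f :: "real \<times> real \<Rightarrow> real" where
    "C0inf (\<lambda>z. complex_of_real (f z))" "continuous_on UNIV f" "\<And>z. 0 \<le> f z"
    "\<And>z. f z \<noteq> 0 \<Longrightarrow> \<exists>c\<in>Z. \<bar>fst z - fst c\<bar> \<le> 2 * \<epsilon> \<and> \<bar>snd z - snd c\<bar> \<le> 2 * \<epsilon>"
    "\<And>z c. c \<in> Z \<Longrightarrow> \<bar>fst z - fst c\<bar> \<le> \<epsilon> \<Longrightarrow> \<bar>snd z - snd c\<bar> \<le> \<epsilon> \<Longrightarrow> exp (- 4) \<le> f z"
    "\<And>p m. 1 \<le> p \<Longrightarrow> 0 < m \<Longrightarrow> 16 * \<epsilon>\<^sup>2 * real (card Z) \<le> m \<Longrightarrow>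
      Lp_norm p lborel (\<lambda>z. ennreal (norm (complex_of_real (f z)))) \<le> ennreal (m powr (1 / real_of_ereal p))"
proof -
  obtain f :: "real \<times> real \<Rightarrow> real" where f:
    "C0inf (\<lambda>z. complex_of_real (f z))" "continuous_on UNIV f" "\<And>z. 0 \<le> f z" "\<And>z. f z \<le> 1"
    "\<And>z. f z \<noteq> 0 \<Longrightarrow> \<exists>c\<in>Z. \<bar>fst z - fst c\<bar> \<le> 2 * \<epsilon> \<and> \<bar>snd z - snd c\<bar> \<le> 2 * \<epsilon>"
    "\<And>z c. c \<in> Z \<Longrightarrow> \<bar>fst z - fst c\<bar> \<le> \<epsilon> \<Longrightarrow> \<bar>snd z - snd c\<bar> \<le> \<epsilon> \<Longrightarrow> exp (- 4) \<le> f z"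
    by (rule ex_smooth_union_boxes[OF Z \<epsilon>], rule that)
  define Q where "Q c = {fst c - 2 * \<epsilon>..fst c + 2 * \<epsilon>} \<times> {snd c - 2 * \<epsilon>..snd c + 2 * \<epsilon>}" for c :: "real \<times> real"
  have Qs: "Q c \<in> sets lborel" for c
    unfolding Q_def by (intro borel_closed[THEN sets_lborel[THEN equalityD2, THEN subsetD]] closed_Times) auto
  have Qm: "emeasure lborel (Q c) = ennreal (16 * \<epsilon>\<^sup>2)" for c
    using \<epsilon> by (simp add: Q_def emeasure_rectangle power2_eq_square)
  have "emeasure lborel (\<Union>c\<in>Z. Q c) \<le> (\<Sum>c\<in>Z. emeasure lborel (Q c))"
    using Z Qs by (intro emeasure_subadditive_finite) auto
  also have "\<dots> = ennreal (16 * \<epsilon>\<^sup>2 * real (card Z))"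
    by (simp add: Qm ennreal_mult ennreal_of_nat_eq_real_of_nat mult.commute)
  finally have U: "emeasure lborel (\<Union>c\<in>Z. Q c) \<le> ennreal (16 * \<epsilon>\<^sup>2 * real (card Z))" .
  have "Lp_norm p lborel (\<lambda>z. ennreal (norm (complex_of_real (f z)))) \<le> ennreal (m powr (1 / real_of_ereal p))"
    if p: "1 \<le> p" and m: "0 < m" "16 * \<epsilon>\<^sup>2 * real (card Z) \<le> m" for p m
  proof (rule Lp_norm_le_of_support[OF p, where S="\<Union>c\<in>Z. Q c"])
    have "f \<in> borel_measurable borel"
      using f(2) by (rule borel_measurable_continuous_onI)
    then show "(\<lambda>z. ennreal (norm (complex_of_real (f z)))) \<in> borel_measurable lborel"
      by simp
    show "(\<Union>c\<in>Z. Q c) \<in> sets lborel"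
      using Z Qs by (intro sets.finite_UN) auto
    show "emeasure lborel (\<Union>c\<in>Z. Q c) \<le> ennreal m"
      using U m(2) by (meson ennreal_leI order_trans)
    show "ennreal (norm (complex_of_real (f z))) \<le> 1" for z
      using f(3,4)[of z] by simp
    show "ennreal (norm (complex_of_real (f z))) = 0" if "z \<notin> (\<Union>c\<in>Z. Q c)" for z
    proof -
      have "f z = 0"
      proof (rule ccontr)
        assume "f z \<noteq> 0"
        from f(5)[OF this] obtain c where "c \<in> Z" "\<bar>fst z - fst c\<bar> \<le> 2 * \<epsilon>" "\<bar>snd z - snd c\<bar> \<le> 2 * \<epsilon>"
          by blast
        then have "z \<in> (\<Union>c\<in>Z. Q c)"
          by (auto simp: Q_def mem_Times_iff abs_le_iff intro!: bexI[of _ c])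
        with that show False by simp
      qed
      then show ?thesis by simp
    qed
  qed (use m in auto)
  note Lp = this
  show ?thesis by (rule that) (fact f Lp)+
qed

section \<open>Lower bounds for the maximal function\<close>

text \<open>
  A piece of the curve on which all lower bounds are produced: the factor \<open>w\<close> rotates \<open>\<eta>\<close> there
  into the right half-plane. It is centred away from the origin, because \<open>\<eta> 0\<close> may vanish and
  because the dilates of the curve fail to be transversal to it at the origin. The bound \<open>r \<le> \<bar>x0\<bar> / 4\<close> keeps
  the interval away from \<open>0\<close>, with room for dilations \<open>t\<close> inside \<open>[1, 2]\<close>.
\<close>

locale curve_piece =
  fixes \<phi> :: "real \<Rightarrow> real" and \<eta> :: "real \<Rightarrow> complex" and x0 r c \<Lambda> :: real and w :: complex
  assumes r: "0 < r" "r \<le> \<bar>x0\<bar> / 4"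
    and c: "0 < c" and w: "norm w \<le> 1" and \<Lambda>: "1 \<le> \<Lambda>"
    and \<eta>_cont: "continuous_on {x0 - r..x0 + r} \<eta>"
    and \<eta>_ge: "x \<in> {x0 - r..x0 + r} \<Longrightarrow> c \<le> Re (w * \<eta> x)"
    and \<eta>_out: "\<eta> x \<noteq> 0 \<Longrightarrow> \<bar>x\<bar> \<le> 1"
    and \<phi>_cont: "continuous_on {x0 - r..x0 + r} \<phi>"
    and \<phi>_inj: "inj_on \<phi> {x0 - r..x0 + r}"
    and lip: "x \<in> {x0 - r..x0 + r} \<Longrightarrow> y \<in> {x0 - r..x0 + r} \<Longrightarrow>
      \<bar>x\<^sup>2 * \<phi> x - y\<^sup>2 * \<phi> y\<bar> \<le> \<Lambda> * \<bar>x - y\<bar>"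
begin

lemma abs_le_1: "x \<in> {x0 - r..x0 + r} \<Longrightarrow> \<bar>x\<bar> \<le> 1"
  using \<eta>_ge[of x] \<eta>_out[of x] c by fastforce

text \<open>
  The test functions are built so that the curve through \<open>y\<close> meets their support only for
  parameters close to \<open>x0\<close>. Then the integrand has nonnegative real part after rotation, whatever
  \<open>\<eta>\<close> does elsewhere.
\<close>

lemma maximal_fun_ge:
  fixes f :: "real \<times> real \<Rightarrow> real"
  assumes t: "t \<in> {1..2}" and f: "continuous_on UNIV f" "\<And>z. 0 \<le> f z"
    and loc: "\<And>x. f (fst y - t * x, snd y - t\<^sup>2 * x\<^sup>2 * \<phi> x) \<noteq> 0 \<Longrightarrow> \<bar>x\<bar> \<le> 1 \<Longrightarrow> x \<in> {x0 - r..x0 + r}"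
    and ab: "a \<le> b" "{a..b} \<subseteq> {x0 - r..x0 + r}" and \<kappa>: "0 \<le> \<kappa>"
    and ge: "\<And>x. x \<in> {a..b} \<Longrightarrow> \<kappa> \<le> f (fst y - t * x, snd y - t\<^sup>2 * x\<^sup>2 * \<phi> x)"
  shows "ennreal (c * \<kappa> * (b - a)) \<le> maximal_fun \<phi> \<eta> (\<lambda>z. complex_of_real (f z)) y"
  unfolding maximal_fun_def
proof (rule SUP_upper2[OF t], rule ennreal_leI)
  let ?h = "\<lambda>x. f (fst y - t * x, snd y - t\<^sup>2 * x\<^sup>2 * \<phi> x)"
  let ?J = "{x0 - r..x0 + r}"
  have Re: "Re (w * (complex_of_real (?h x) * \<eta> x)) = ?h x * Re (w * \<eta> x)" for x
    by (simp add: algebra_simps)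
  have pos: "0 \<le> Re (w * \<eta> x)" if "x \<in> ?J" for x
    using \<eta>_ge[OF that] c by simp
  show "c * \<kappa> * (b - a) \<le> norm (LINT x|lborel. complex_of_real (?h x) * \<eta> x)"
  proof (rule norm_integral_ge[where S="?J" and w=w])
    show "continuous_on ?J (\<lambda>x. complex_of_real (?h x) * \<eta> x)"
      by (intro continuous_intros continuous_on_compose2[OF f(1)] \<eta>_cont \<phi>_cont) auto
    show "complex_of_real (?h x) * \<eta> x = 0" if "x \<notin> ?J" for x
      using that loc[of x] \<eta>_out[of x] by auto
    show "0 \<le> Re (w * (complex_of_real (?h x) * \<eta> x))" if "x \<in> ?J" for x
      unfolding Re using f(2) pos[OF that] by simp
    show "c * \<kappa> \<le> Re (w * (complex_of_real (?h x) * \<eta> x))" if "x \<in> {a..b}" for x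
      unfolding Re using ge[OF that] \<eta>_ge[of x] that ab(2) c \<kappa> f(2) 
      by (subst mult.commute) (intro mult_mono; auto)
  qed (use ab w in auto)
qed

text \<open>
  The dilated curves fill a set with interior points, because \<open>\<phi>\<close> is not constant. Indeed,
  \<open>y = (t * x, t\<^sup>2 * x\<^sup>2 * \<phi> x)\<close> says that \<open>\<phi> x = snd y / (fst y)\<^sup>2\<close> and \<open>t = fst y / x\<close>. The first
  equation is solved by the intermediate value theorem as soon as \<open>snd y / (fst y)\<^sup>2\<close> lies between
  two values of \<open>\<phi>\<close> near \<open>x0\<close>; the second then defines a \<open>t\<close> in \<open>[1, 2]\<close> when \<open>fst y\<close> is
  close to \<open>3 / 2 * x0\<close>. For constant \<open>\<phi>\<close> all dilates would lie on a single parabola.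
\<close>

lemma swept_rectangle:
  obtains u1 u2 v1 v2 where "u1 < u2" "v1 < v2"
    "\<And>y. y \<in> {u1..u2} \<times> {v1..v2} \<Longrightarrow>
      \<exists>t\<in>{1..2}. \<exists>x\<in>{x0 - r / 2..x0 + r / 2}. y = (t * x, t\<^sup>2 * x\<^sup>2 * \<phi> x)"
proof -
  define s1 s2 where "s1 = min (\<phi> x0) (\<phi> (x0 + r / 2))" and "s2 = max (\<phi> x0) (\<phi> (x0 + r / 2))"
  have "\<phi> x0 \<noteq> \<phi> (x0 + r / 2)"
    using inj_onD[OF \<phi>_inj, of x0 "x0 + r / 2"] r by auto
  then have s: "s1 < s2" by (auto simp: s1_def s2_def)
  have x0: "x0 \<noteq> 0" using r by auto
  define U where "U = {y :: real \<times> real. 11 / 8 < fst y / x0 \<and> fst y / x0 < 13 / 8 \<and>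
    s1 * (fst y)\<^sup>2 < snd y \<and> snd y < s2 * (fst y)\<^sup>2}"
  have "open U"
    unfolding U_def using x0 by (intro open_Collect_conj open_Collect_less continuous_intros) auto
  moreover define y0 where "y0 = (3 / 2 * x0, (s1 + s2) / 2 * (3 / 2 * x0)\<^sup>2)"
  have "y0 \<in> U"
    using x0 s by (auto simp: U_def y0_def intro!: mult_strict_right_mono)
  ultimately obtain a b where ab: "y0 \<in> box a b" "cbox a b \<subseteq> U"
    using open_contains_cbox by metis
  have lt: "fst a < fst b" "snd a < snd b"
    using ab(1) by (auto simp: mem_box Basis_prod_def inner_prod_def)
  show ?thesis
  proof
    fix y assume "y \<in> {fst a..fst b} \<times> {snd a..snd b}"
    then have "y \<in> cbox a b"
      by (cases a; cases b) (auto simp: cbox_Pair_eq)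
    with ab(2) have y: "11 / 8 < fst y / x0" "fst y / x0 < 13 / 8"
      "s1 * (fst y)\<^sup>2 < snd y" "snd y < s2 * (fst y)\<^sup>2"
      by (auto simp: U_def)
    then have y0: "fst y \<noteq> 0" by auto
    define s where "s = snd y / (fst y)\<^sup>2"
    have "s1 \<le> s" "s \<le> s2"
      using y y0 by (auto simp: s_def field_simps)
    moreover have "connected (\<phi> ` {x0..x0 + r / 2})"
      by (intro connected_continuous_image continuous_on_subset[OF \<phi>_cont]) (use r in auto)
    moreover have "s1 \<in> \<phi> ` {x0..x0 + r / 2}" "s2 \<in> \<phi> ` {x0..x0 + r / 2}"
      using r by (auto simp: s1_def s2_def min_def max_def)
    ultimately have "s \<in> \<phi> ` {x0..x0 + r / 2}"
      using connectedD_interval by blast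
    then obtain x where x: "x \<in> {x0..x0 + r / 2}" "\<phi> x = s" by auto
    define \<rho> \<sigma> where "\<rho> = fst y / x0" and "\<sigma> = x / x0"
    have "\<bar>\<sigma> - 1\<bar> = \<bar>x - x0\<bar> / \<bar>x0\<bar>"
      using x0 by (simp add: \<sigma>_def diff_divide_distrib flip: abs_divide)
    also have "\<dots> \<le> 1 / 8" using x(1) r x0 by (auto simp: field_simps)
    finally have \<sigma>: "7 / 8 \<le> \<sigma>" "\<sigma> \<le> 9 / 8" by linarith+
    have xn: "x \<noteq> 0" using \<sigma> by (auto simp: \<sigma>_def)
    define t where "t = fst y / x"
    have "t = \<rho> / \<sigma>" using x0 by (simp add: t_def \<rho>_def \<sigma>_def)
    moreover have "11 / 8 < \<rho>" "\<rho> < 13 / 8" using y by (simp_all add: \<rho>_def)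
    ultimately have "t \<in> {1..2}" using \<sigma> by (simp add: pos_le_divide_eq pos_divide_le_eq)
    moreover have "y = (t * x, t\<^sup>2 * x\<^sup>2 * \<phi> x)"
      using xn y0 x(2) by (auto simp: t_def s_def prod_eq_iff power_divide)
    ultimately show "\<exists>t\<in>{1..2}. \<exists>x\<in>{x0 - r / 2..x0 + r / 2}. y = (t * x, t\<^sup>2 * x\<^sup>2 * \<phi> x)"
      using x(1) r by (intro bexI[of _ t] bexI[of _ x]) auto
  qed (use lt in auto)
qed

text \<open>
  The test function lives on \<open>N\<close> squares of side comparable to \<open>\<epsilon>\<close>, placed far apart. If \<open>y\<close> lies in
  the translate of the swept rectangle that belongs to one of them, then for some \<open>t\<close> the
  curve \<open>x \<mapsto> y - (t * x, t\<^sup>2 * x\<^sup>2 * \<phi> x)\<close> passes through the centre of that square and spends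
  a parameter interval of length comparable to \<open>\<epsilon>\<close> in it. It meets none of the other squares, since \<open>10\<close> exceeds the horizontal extent of
  all the curves involved.
\<close>

lemma translated_boxes:
  fixes u1 u2 v1 v2 \<epsilon> :: real and N :: nat
  defines "S \<equiv> (\<Union>k<N. {u1 + 10 * real k..u2 + 10 * real k} \<times> {v1..v2})"
  assumes uv: "u1 < u2" "v1 < v2"
    and swept: "\<And>y. y \<in> {u1..u2} \<times> {v1..v2} \<Longrightarrow>
      \<exists>t\<in>{1..2}. \<exists>x\<in>{x0 - r / 2..x0 + r / 2}. y = (t * x, t\<^sup>2 * x\<^sup>2 * \<phi> x)"
    and \<epsilon>: "0 < \<epsilon>" "\<epsilon> \<le> r / 4" and N: "1 \<le> N"
  obtains f :: "real \<times> real \<Rightarrow> real" where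
    "C0inf (\<lambda>z. complex_of_real (f z))"
    "\<And>p. 1 \<le> p \<Longrightarrow> Lp_norm p lborel (\<lambda>z. ennreal (norm (complex_of_real (f z))))
      \<le> ennreal ((16 * \<epsilon>\<^sup>2 * real N) powr (1 / real_of_ereal p))"
    "S \<in> sets lborel" "emeasure lborel S = ennreal (real N * ((u2 - u1) * (v2 - v1)))"
    "\<And>y. y \<in> S \<Longrightarrow> ennreal (c * exp (- 4) / (2 * \<Lambda>) * \<epsilon>) \<le> maximal_fun \<phi> \<eta> (\<lambda>z. complex_of_real (f z)) y"
proof -
  define Z where "Z = (\<lambda>k. (10 * real k, 0::real)) ` {..<N}"
  have Z: "finite Z" "card Z = N"
    unfolding Z_def by (auto intro!: card_image[THEN trans] inj_onI)
  obtain f :: "real \<times> real \<Rightarrow> real" where f: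
    "C0inf (\<lambda>z. complex_of_real (f z))" "continuous_on UNIV f" "\<And>z. 0 \<le> f z"
    "\<And>z. f z \<noteq> 0 \<Longrightarrow> \<exists>c\<in>Z. \<bar>fst z - fst c\<bar> \<le> 2 * \<epsilon> \<and> \<bar>snd z - snd c\<bar> \<le> 2 * \<epsilon>"
    "\<And>z c. c \<in> Z \<Longrightarrow> \<bar>fst z - fst c\<bar> \<le> \<epsilon> \<Longrightarrow> \<bar>snd z - snd c\<bar> \<le> \<epsilon> \<Longrightarrow> exp (- 4) \<le> f z"
    "\<And>p m. 1 \<le> p \<Longrightarrow> 0 < m \<Longrightarrow> 16 * \<epsilon>\<^sup>2 * real (card Z) \<le> m \<Longrightarrow>
      Lp_norm p lborel (\<lambda>z. ennreal (norm (complex_of_real (f z)))) \<le> ennreal (m powr (1 / real_of_ereal p))"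
    by (rule ex_test_function[OF Z(1) \<epsilon>(1)], rule that)
  have tx: "\<bar>t * x\<bar> \<le> 2" if "t \<in> {1..2}" "\<bar>x\<bar> \<le> 1" for t x :: real
    using that mult_mono[of "\<bar>t\<bar>" 2 "\<bar>x\<bar>" 1] by (simp add: abs_mult)
  have u_bound: "\<bar>u\<bar> \<le> 2" if u: "u \<in> {u1..u2}" for u
  proof -
    obtain t x where "t \<in> {1..2}" "x \<in> {x0 - r / 2..x0 + r / 2}" "u = t * x"
      using swept[of "(u, v1)"] u uv by auto
    then show ?thesis using tx[of t x] abs_le_1[of x] r by auto
  qed
  have r1: "r \<le> 1" using abs_le_1[of "x0 - r"] abs_le_1[of "x0 + r"] r by auto
  let ?R = "\<lambda>k. {u1 + 10 * real k..u2 + 10 * real k} \<times> {v1..v2}"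
  have Rs: "?R k \<in> sets lborel" for k
    by (simp add: closed_Times borel_closed)
  have disj: "disjoint_family_on ?R {..<N}"
    unfolding disjoint_family_on_def
  proof (intro ballI impI)
    fix k l :: nat assume "k \<noteq> l"
    then have "real k + 1 \<le> real l \<or> real l + 1 \<le> real k" by linarith
    moreover have "u2 - u1 \<le> 4" using u_bound[of u1] u_bound[of u2] uv by auto
    ultimately show "?R k \<inter> ?R l = {}" by auto
  qed
  have mS: "emeasure lborel S = ennreal (real N * ((u2 - u1) * (v2 - v1)))"
  proof -
    have "emeasure lborel S = (\<Sum>k<N. emeasure lborel (?R k))"
      unfolding S_def using Rs disj by (intro sum_emeasure[symmetric]) auto
    also have "\<dots> = (\<Sum>k<N. ennreal ((u2 - u1) * (v2 - v1)))"
      using uv by (intro sum.cong refl) (simp add: emeasure_rectangle)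
    also have "\<dots> = ennreal (real N * ((u2 - u1) * (v2 - v1)))"
      using uv by (simp add: ennreal_mult ennreal_of_nat_eq_real_of_nat)
    finally show ?thesis .
  qed
  have "ennreal (c * exp (- 4) / (2 * \<Lambda>) * \<epsilon>) \<le> maximal_fun \<phi> \<eta> (\<lambda>z. complex_of_real (f z)) y"
    if y: "y \<in> S" for y
  proof -
    from y obtain k where k: "k < N" "fst y - 10 * real k \<in> {u1..u2}" "snd y \<in> {v1..v2}"
      unfolding S_def by auto
    with swept[of "(fst y - 10 * real k, snd y)"] obtain t z where tz: "t \<in> {1..2}"
      "z \<in> {x0 - r / 2..x0 + r / 2}" "fst y = t * z + 10 * real k" "snd y = t\<^sup>2 * z\<^sup>2 * \<phi> z"
      by auto
    \<comment> \<open>Within parameter distance \<open>h\<close> both coordinates of the dilated curve, whose Lipschitz constants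
      are at most \<open>2\<close> and \<open>4 * \<Lambda>\<close>, move by at most \<open>\<epsilon>\<close>.\<close>
    define h where "h = \<epsilon> / (4 * \<Lambda>)"
    have h: "0 < h" "h \<le> \<epsilon> / 4" "\<Lambda> * h = \<epsilon> / 4"
      using \<Lambda> \<epsilon> by (auto simp: h_def field_simps)
    have zJ: "{z - h..z + h} \<subseteq> {x0 - r..x0 + r}"
      using h \<epsilon> tz(2) by auto
    have "ennreal (c * exp (- 4) * ((z + h) - (z - h)))
        \<le> maximal_fun \<phi> \<eta> (\<lambda>z. complex_of_real (f z)) y"
    proof (rule maximal_fun_ge[OF tz(1) f(2,3)])
      fix x assume nz: "f (fst y - t * x, snd y - t\<^sup>2 * x\<^sup>2 * \<phi> x) \<noteq> 0" and x1: "\<bar>x\<bar> \<le> 1"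
      from f(4)[OF nz] obtain l where l: "\<bar>fst y - t * x - 10 * real l\<bar> \<le> 2 * \<epsilon>"
        by (auto simp: Z_def)
      have "\<bar>t * z\<bar> \<le> 2" "\<bar>t * x\<bar> \<le> 2"
        using tx[of t z] tx[of t x] tz x1 abs_le_1[of z] r by auto
      with l \<epsilon> r1 tz(3) have "k = l" by linarith
      with l tz(3) have "\<bar>t * (z - x)\<bar> \<le> 2 * \<epsilon>" by (simp add: algebra_simps)
      moreover have "1 * \<bar>z - x\<bar> \<le> \<bar>t * (z - x)\<bar>"
        unfolding abs_mult using tz(1) by (intro mult_right_mono) auto
      ultimately have "\<bar>z - x\<bar> \<le> 2 * \<epsilon>" by simp
      then have "\<bar>z - x\<bar> \<le> r / 2" using \<epsilon> by linarith
      with tz(2) show "x \<in> {x0 - r..x0 + r}"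
        unfolding atLeastAtMost_iff by linarith
    next
      fix x assume x: "x \<in> {z - h..z + h}"
      then have xz: "\<bar>z - x\<bar> \<le> h" by (auto simp: abs_le_iff)
      have "\<bar>t * (z - x)\<bar> \<le> 2 * h"
        unfolding abs_mult using tz(1) xz h by (intro mult_mono) auto
      then have 1: "\<bar>t * (z - x)\<bar> \<le> \<epsilon>" using h \<epsilon> by linarith
      have "z \<in> {x0 - r..x0 + r}" "x \<in> {x0 - r..x0 + r}"
        using zJ x h by auto
      then have "\<bar>z\<^sup>2 * \<phi> z - x\<^sup>2 * \<phi> x\<bar> \<le> \<Lambda> * \<bar>z - x\<bar>" by (rule lip)
      also have "\<dots> \<le> \<Lambda> * h" using \<Lambda> xz by (intro mult_left_mono) auto
      finally have "\<bar>z\<^sup>2 * \<phi> z - x\<^sup>2 * \<phi> x\<bar> \<le> \<epsilon> / 4" using h by simp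
      moreover have "t\<^sup>2 \<le> 2\<^sup>2" using tz(1) by (intro power_mono) auto
      ultimately have "\<bar>t\<^sup>2 * (z\<^sup>2 * \<phi> z - x\<^sup>2 * \<phi> x)\<bar> \<le> 2\<^sup>2 * (\<epsilon> / 4)"
        unfolding abs_mult by (intro mult_mono) auto
      then have 2: "\<bar>t\<^sup>2 * (z\<^sup>2 * \<phi> z - x\<^sup>2 * \<phi> x)\<bar> \<le> \<epsilon>" by simp
      show "exp (- 4) \<le> f (fst y - t * x, snd y - t\<^sup>2 * x\<^sup>2 * \<phi> x)"
        by (rule f(5)[of "(10 * real k, 0)"]) (use 1 2 k tz in \<open>auto simp: Z_def algebra_simps\<close>)
    qed (use h zJ in auto)
    also have "c * exp (- 4) * ((z + h) - (z - h)) = c * exp (- 4) / (2 * \<Lambda>) * \<epsilon>"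
      by (simp add: h_def)
    finally show ?thesis .
  qed
  moreover have "S \<in> sets lborel" unfolding S_def using Rs by (intro sets.finite_UN) auto
  moreover have "0 < 16 * \<epsilon>\<^sup>2 * real N" using \<epsilon> N by simp
  ultimately show ?thesis
    using f(1) mS f(6)[of _ "16 * \<epsilon>\<^sup>2 * real N"] Z(2) by (intro that) auto
qed

text \<open>
  Here the test function lives on about \<open>1 / \<epsilon>\<close> squares of side comparable to \<open>\<epsilon>\<close> that cover the
  reflected curve near \<open>- x0\<close>, of total area comparable to \<open>\<epsilon>\<close>. For every \<open>y\<close> within \<open>\<epsilon> / 2\<close> of
  the origin the curve \<open>x \<mapsto> y - (x, x\<^sup>2 * \<phi> x)\<close> stays inside them for all parameters near \<open>x0\<close>, so
  the maximal function is bounded below independently of \<open>\<epsilon>\<close>.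
\<close>

lemma tiled_curve:
  assumes \<epsilon>: "0 < \<epsilon>" "\<epsilon> \<le> r / 6"
  obtains f :: "real \<times> real \<Rightarrow> real" where
    "C0inf (\<lambda>z. complex_of_real (f z))"
    "\<And>p. 1 \<le> p \<Longrightarrow> Lp_norm p lborel (\<lambda>z. ennreal (norm (complex_of_real (f z))))
      \<le> ennreal ((48 * r * \<Lambda> * \<epsilon>) powr (1 / real_of_ereal p))"
    "\<And>y. y \<in> {- \<epsilon> / 2..\<epsilon> / 2} \<times> {- \<epsilon> / 2..\<epsilon> / 2} \<Longrightarrow>
      ennreal (c * exp (- 4) * r) \<le> maximal_fun \<phi> \<eta> (\<lambda>z. complex_of_real (f z)) y"
proof -
  \<comment> \<open>With nodes at this spacing the curve moves by at most \<open>\<epsilon> / 2\<close> from one node to the next; the other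
    half of the tolerance is left for \<open>y\<close>.\<close>
  define h where "h = \<epsilon> / (2 * \<Lambda>)"
  have h: "0 < h" "h \<le> \<epsilon> / 2" "\<Lambda> * h = \<epsilon> / 2"
    using \<Lambda> \<epsilon> by (auto simp: h_def field_simps)
  define n where "n = nat \<lfloor>r / h\<rfloor>"
  have n: "real n \<le> r / h" unfolding n_def using h r by (intro of_nat_floor) auto
  define X where "X j = x0 - r / 2 + real j * h" for j :: nat
  have X: "X j \<in> {x0 - r / 2..x0 + r / 2}" if "j \<le> n" for j
  proof -
    have "real j * h \<le> r" using that n order.trans[of "real j" "real n" "r / h"] h
      by (simp add: pos_le_divide_eq)
    then show ?thesis using h by (auto simp: X_def)
  qed
  define Z where "Z = (\<lambda>j. (- X j, - ((X j)\<^sup>2 * \<phi> (X j)))) ` {..n}"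
  have Z: "finite Z" by (simp add: Z_def)
  have "card Z \<le> n + 1" unfolding Z_def using card_image_le[of "{..n}"] by simp
  then have "real (card Z) \<le> r / h + 1" using n by linarith
  also have "\<dots> \<le> 3 * r * \<Lambda> / \<epsilon>"
  proof -
    have "1 * \<epsilon> \<le> \<Lambda> * r" using \<Lambda> \<epsilon> r by (intro mult_mono) auto
    then show ?thesis using \<epsilon> \<Lambda> by (simp add: h_def field_simps)
  qed
  finally have "16 * \<epsilon>\<^sup>2 * real (card Z) \<le> 16 * \<epsilon>\<^sup>2 * (3 * r * \<Lambda> / \<epsilon>)"
    by (intro mult_left_mono) auto
  then have cZ: "16 * \<epsilon>\<^sup>2 * real (card Z) \<le> 48 * r * \<Lambda> * \<epsilon>"
    using \<epsilon> by (simp add: power2_eq_square mult_ac)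
  obtain f :: "real \<times> real \<Rightarrow> real" where f:
    "C0inf (\<lambda>z. complex_of_real (f z))" "continuous_on UNIV f" "\<And>z. 0 \<le> f z"
    "\<And>z. f z \<noteq> 0 \<Longrightarrow> \<exists>c\<in>Z. \<bar>fst z - fst c\<bar> \<le> 2 * \<epsilon> \<and> \<bar>snd z - snd c\<bar> \<le> 2 * \<epsilon>"
    "\<And>z c. c \<in> Z \<Longrightarrow> \<bar>fst z - fst c\<bar> \<le> \<epsilon> \<Longrightarrow> \<bar>snd z - snd c\<bar> \<le> \<epsilon> \<Longrightarrow> exp (- 4) \<le> f z"
    "\<And>p m. 1 \<le> p \<Longrightarrow> 0 < m \<Longrightarrow> 16 * \<epsilon>\<^sup>2 * real (card Z) \<le> m \<Longrightarrow>
      Lp_norm p lborel (\<lambda>z. ennreal (norm (complex_of_real (f z)))) \<le> ennreal (m powr (1 / real_of_ereal p))"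
    by (rule ex_test_function[OF Z(1) \<epsilon>(1)], rule that)
  have "ennreal (c * exp (- 4) * r) \<le> maximal_fun \<phi> \<eta> (\<lambda>z. complex_of_real (f z)) y"
    if y: "y \<in> {- \<epsilon> / 2..\<epsilon> / 2} \<times> {- \<epsilon> / 2..\<epsilon> / 2}" for y
  proof -
    have y: "\<bar>fst y\<bar> \<le> \<epsilon> / 2" "\<bar>snd y\<bar> \<le> \<epsilon> / 2" using y by auto
    have "ennreal (c * exp (- 4) * ((x0 + r / 2) - (x0 - r / 2)))
        \<le> maximal_fun \<phi> \<eta> (\<lambda>z. complex_of_real (f z)) y"
    proof (rule maximal_fun_ge[of 1, OF _ f(2,3)])
      fix x assume "f (fst y - 1 * x, snd y - 1\<^sup>2 * x\<^sup>2 * \<phi> x) \<noteq> 0"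
      from f(4)[OF this] obtain j where "j \<le> n" "\<bar>fst y - x + X j\<bar> \<le> 2 * \<epsilon>"
        by (auto simp: Z_def)
      with X[of j] y \<epsilon> show "x \<in> {x0 - r..x0 + r}"
        unfolding atLeastAtMost_iff by linarith
    next
      fix x assume x: "x \<in> {x0 - r / 2..x0 + r / 2}"
      define j where "j = nat \<lfloor>(x - (x0 - r / 2)) / h\<rfloor>"
      have nonneg: "0 \<le> (x - (x0 - r / 2)) / h" using x h by auto
      have "(x - (x0 - r / 2)) / h \<le> r / h"
        using x h by (intro divide_right_mono) auto
      then have j: "j \<le> n" unfolding j_def n_def by (intro nat_mono floor_mono)
      have "real j \<le> (x - (x0 - r / 2)) / h" "(x - (x0 - r / 2)) / h \<le> real j + 1"
        using nonneg unfolding j_def by linarith+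
      then have "real j * h \<le> x - (x0 - r / 2)" "x - (x0 - r / 2) \<le> (real j + 1) * h"
        using h by (simp_all add: pos_le_divide_eq pos_divide_le_eq)
      then have xX: "\<bar>X j - x\<bar> \<le> h" by (auto simp: X_def algebra_simps abs_le_iff)
      have "\<bar>(X j)\<^sup>2 * \<phi> (X j) - x\<^sup>2 * \<phi> x\<bar> \<le> \<Lambda> * \<bar>X j - x\<bar>"
        using X[OF j] x r by (intro lip) auto
      also have "\<dots> \<le> \<Lambda> * h" using \<Lambda> xX by (intro mult_left_mono) auto
      finally have 2: "\<bar>(X j)\<^sup>2 * \<phi> (X j) - x\<^sup>2 * \<phi> x\<bar> \<le> \<epsilon> / 2" using h by simp
      have 3: "\<bar>X j - x\<bar> \<le> \<epsilon> / 2" using xX h by linarith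
      show "exp (- 4) \<le> f (fst y - 1 * x, snd y - 1\<^sup>2 * x\<^sup>2 * \<phi> x)"
      proof (rule f(5))
        show "(- X j, - ((X j)\<^sup>2 * \<phi> (X j))) \<in> Z" using j by (auto simp: Z_def)
        show "\<bar>fst (fst y - 1 * x, snd y - 1\<^sup>2 * x\<^sup>2 * \<phi> x) - fst (- X j, - ((X j)\<^sup>2 * \<phi> (X j)))\<bar> \<le> \<epsilon>"
          unfolding fst_conv using y 3 by linarith
        show "\<bar>snd (fst y - 1 * x, snd y - 1\<^sup>2 * x\<^sup>2 * \<phi> x) - snd (- X j, - ((X j)\<^sup>2 * \<phi> (X j)))\<bar> \<le> \<epsilon>"
          unfolding snd_conv power_one mult_1_left using y 2 by linarith
      qed
    qed (use r in auto)
    then show ?thesis by simp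
  qed
  moreover have "0 < 48 * r * \<Lambda> * \<epsilon>" using \<epsilon> r \<Lambda> by simp
  ultimately show ?thesis
    using f(1) cZ f(6)[of _ "48 * r * \<Lambda> * \<epsilon>"] by (intro that) auto
qed

text \<open>
  With \<open>\<epsilon>\<close> fixed and \<open>N\<close> tending to infinity the translated squares give \<open>a \<le> b\<close>. With \<open>N = 1\<close> and
  \<open>\<epsilon>\<close> tending to \<open>0\<close> they give \<open>\<epsilon> \<le> const * \<epsilon> powr (2 * b)\<close>, hence \<open>b \<le> 1 / 2\<close>. The tiled curve gives
  \<open>\<epsilon> powr (2 * a) \<le> const * \<epsilon> powr b\<close>, hence \<open>b \<le> 2 * a\<close>.
\<close>

lemma exponent_conditions:
  fixes p q :: ereal
  defines "a \<equiv> 1 / real_of_ereal q" and "b \<equiv> 1 / real_of_ereal p"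
  assumes pq: "1 \<le> p" "1 \<le> q" and C: "0 \<le> C"
    and bound: "\<forall>f. C0inf f \<longrightarrow> Lp_norm q lborel (maximal_fun \<phi> \<eta> f)
      \<le> ennreal C * Lp_norm p lborel (\<lambda>y. ennreal (norm (f y)))"
  shows "a \<le> b" "b \<le> 2 * a" "b \<le> 1 / 2"
proof -
  have combine: "k * m powr a \<le> C * M powr b"
    if f: "C0inf f" and M: "Lp_norm p lborel (\<lambda>y. ennreal (norm (f y))) \<le> ennreal (M powr b)"
      and S: "S \<in> sets lborel" "emeasure lborel S = ennreal m" "0 < m" and k: "0 \<le> k"
      and ge: "\<And>y. y \<in> S \<Longrightarrow> ennreal k \<le> maximal_fun \<phi> \<eta> f y"
    for f S k m M
  proof -
    have "ennreal (k * m powr a) \<le> Lp_norm q lborel (maximal_fun \<phi> \<eta> f)"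
      unfolding a_def by (rule Lp_norm_ge_on[OF pq(2) S k ge])
    also have "\<dots> \<le> ennreal C * Lp_norm p lborel (\<lambda>y. ennreal (norm (f y)))"
      by (rule bound[rule_format, OF f])
    also have "\<dots> \<le> ennreal C * ennreal (M powr b)"
      using M by (rule mult_left_mono) simp
    also have "\<dots> = ennreal (C * M powr b)"
      using C by (simp add: ennreal_mult)
    finally show ?thesis using C by (simp add: ennreal_le_iff)
  qed
  obtain u1 u2 v1 v2 where uv: "u1 < u2" "v1 < v2"
    and swept: "\<And>y. y \<in> {u1..u2} \<times> {v1..v2} \<Longrightarrow>
      \<exists>t\<in>{1..2}. \<exists>x\<in>{x0 - r / 2..x0 + r / 2}. y = (t * x, t\<^sup>2 * x\<^sup>2 * \<phi> x)"
    by (rule swept_rectangle) blast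
  define m where "m = (u2 - u1) * (v2 - v1)"
  have m: "m > 0" using uv by (simp add: m_def)
  define \<kappa> where "\<kappa> = c * exp (- 4) / (2 * \<Lambda>)"
  have \<kappa>: "\<kappa> > 0" using c \<Lambda> by (simp add: \<kappa>_def)
  have boxes: "\<kappa> * \<epsilon> * (real N * m) powr a \<le> C * (16 * \<epsilon>\<^sup>2 * real N) powr b"
    if \<epsilon>: "0 < \<epsilon>" "\<epsilon> \<le> r / 4" and N: "1 \<le> N" for \<epsilon> N
  proof (rule translated_boxes[OF uv swept \<epsilon> N])
    fix f :: "real \<times> real \<Rightarrow> real"
    let ?S = "\<Union>k<N. {u1 + 10 * real k..u2 + 10 * real k} \<times> {v1..v2}"
    assume f: "C0inf (\<lambda>z. complex_of_real (f z))"
      "\<And>p. 1 \<le> p \<Longrightarrow> Lp_norm p lborel (\<lambda>z. ennreal (norm (complex_of_real (f z))))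
        \<le> ennreal ((16 * \<epsilon>\<^sup>2 * real N) powr (1 / real_of_ereal p))"
      "?S \<in> sets lborel" "emeasure lborel ?S = ennreal (real N * ((u2 - u1) * (v2 - v1)))"
      "\<And>y. y \<in> ?S \<Longrightarrow> ennreal (c * exp (- 4) / (2 * \<Lambda>) * \<epsilon>) \<le> maximal_fun \<phi> \<eta> (\<lambda>z. complex_of_real (f z)) y"
    show ?thesis
      by (rule combine[OF f(1) _ f(3) _ _ _ f(5)[folded \<kappa>_def]])
        (use f(2)[OF pq(1)] f(4) m \<kappa> \<epsilon> N in \<open>auto simp: b_def m_def\<close>)
  qed
  have inv_powr: "(1 / real n) powr s = real n powr (- s)" for n :: nat and s
    by (simp add: powr_minus_divide powr_divide)
  have inv2_powr: "((1 / real n)\<^sup>2) powr s = real n powr (- (2 * s))" if "n \<ge> 1" for n :: nat and s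
  proof -
    have "((1 / real n)\<^sup>2) powr s = ((1 / real n) powr 2) powr s"
      using that by (simp add: powr_numeral)
    then show ?thesis by (simp only: powr_powr inv_powr mult_minus_left)
  qed
  have small: "0 < 1 / real n" "1 / real n \<le> r / 6" "n \<ge> 1" if "n \<ge> nat \<lceil>6 / r\<rceil> + 1" for n
  proof -
    have "6 / r \<le> real n" "n \<ge> 1" using that by linarith+
    then show "0 < 1 / real n" "1 / real n \<le> r / 6" "n \<ge> 1" using r by (auto simp: field_simps)
  qed
  \<comment> \<open>The number of squares grows at a fixed scale.\<close>
  show "a \<le> b"
  proof (rule exponent_le_of_power_bound)
    show "\<kappa> * (r / 4) * m powr a > 0" using \<kappa> m r by simp
    show "\<kappa> * (r / 4) * m powr a * real N powr a \<le> C * (16 * (r / 4)\<^sup>2) powr b * real N powr b"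
      if "N \<ge> 1" for N
      using boxes[of "r / 4" N] r that m by (simp add: powr_mult mult_ac)
  qed
  \<comment> \<open>A single square shrinks.\<close>
  have "- 1 \<le> - (2 * b)"
  proof (rule exponent_le_of_power_bound)
    show "\<kappa> * m powr a > 0" using \<kappa> m by simp
    show "\<kappa> * m powr a * real n powr (- 1) \<le> C * 16 powr b * real n powr (- (2 * b))"
      if n: "n \<ge> nat \<lceil>6 / r\<rceil> + 1" for n
    proof -
      have "1 / real n \<le> r / 4" using small(2)[OF n] r by linarith
      then have "\<kappa> * (1 / real n) * m powr a \<le> C * (16 * (1 / real n)\<^sup>2) powr b"
        using boxes[of "1 / real n" 1] small[OF n] by simp
      also have "\<dots> = C * 16 powr b * real n powr (- (2 * b))"
        by (simp only: powr_mult inv2_powr[OF small(3)[OF n]] mult.assoc)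
      finally show ?thesis
        using small(3)[OF n] by (simp add: powr_minus_divide mult_ac)
    qed
  qed
  then show "b \<le> 1 / 2" by simp
  define K where "K = 48 * r * \<Lambda>"
  have K: "K > 0" using r \<Lambda> by (simp add: K_def)
  \<comment> \<open>The tiles around the curve shrink.\<close>
  have "- (2 * a) \<le> - b"
  proof (rule exponent_le_of_power_bound)
    show "0 < c * exp (- 4) * r" using c r by simp
    show "c * exp (- 4) * r * real n powr (- (2 * a)) \<le> C * K powr b * real n powr (- b)"
      if n: "n \<ge> nat \<lceil>6 / r\<rceil> + 1" for n
    proof -
      define \<epsilon> where "\<epsilon> = 1 / real n"
      have \<epsilon>: "0 < \<epsilon>" "\<epsilon> \<le> r / 6" using small[OF n] by (simp_all add: \<epsilon>_def)
      let ?S = "{- \<epsilon> / 2..\<epsilon> / 2} \<times> {- \<epsilon> / 2..\<epsilon> / 2}"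
      have "c * exp (- 4) * r * (\<epsilon>\<^sup>2) powr a \<le> C * (K * \<epsilon>) powr b"
      proof (rule tiled_curve[OF \<epsilon>])
        fix f :: "real \<times> real \<Rightarrow> real"
        assume f: "C0inf (\<lambda>z. complex_of_real (f z))"
          "\<And>p. 1 \<le> p \<Longrightarrow> Lp_norm p lborel (\<lambda>z. ennreal (norm (complex_of_real (f z))))
            \<le> ennreal ((48 * r * \<Lambda> * \<epsilon>) powr (1 / real_of_ereal p))"
          "\<And>y. y \<in> ?S \<Longrightarrow> ennreal (c * exp (- 4) * r) \<le> maximal_fun \<phi> \<eta> (\<lambda>z. complex_of_real (f z)) y"
        show ?thesis
        proof (rule combine[OF f(1) _ _ _ _ _ f(3)])
          show "?S \<in> sets lborel" by (simp add: closed_Times borel_closed)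
          show "emeasure lborel ?S = ennreal (\<epsilon>\<^sup>2)"
            using \<epsilon> by (simp add: emeasure_rectangle power2_eq_square)
        qed (use f(2)[OF pq(1)] \<epsilon> c r in \<open>auto simp: b_def K_def\<close>)
      qed
      then show ?thesis
        by (simp only: \<epsilon>_def powr_mult inv2_powr[OF small(3)[OF n]] inv_powr mult.assoc)
    qed
  qed
  then show "b \<le> 2 * a" by simp
qed

end

section \<open>The necessary conditions\<close>

lemma square_mult_lipschitz:
  fixes \<phi> :: "real \<Rightarrow> real"
  assumes "\<bar>x\<bar> \<le> 1" "\<bar>y\<bar> \<le> 1" "\<bar>\<phi> y\<bar> \<le> B" "\<bar>\<phi> x - \<phi> y\<bar> \<le> L * \<bar>x - y\<bar>"
  shows "\<bar>x\<^sup>2 * \<phi> x - y\<^sup>2 * \<phi> y\<bar> \<le> (L + 2 * B) * \<bar>x - y\<bar>"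
proof -
  have "x\<^sup>2 * \<phi> x - y\<^sup>2 * \<phi> y = x\<^sup>2 * (\<phi> x - \<phi> y) + (x + y) * \<phi> y * (x - y)"
    by (simp add: algebra_simps power2_eq_square)
  also have "\<bar>\<dots>\<bar> \<le> x\<^sup>2 * \<bar>\<phi> x - \<phi> y\<bar> + \<bar>x + y\<bar> * \<bar>\<phi> y\<bar> * \<bar>x - y\<bar>"
    by (rule order_trans[OF abs_triangle_ineq]) (simp add: abs_mult)
  also have "\<dots> \<le> 1 * (L * \<bar>x - y\<bar>) + 2 * B * \<bar>x - y\<bar>"
    using assms by (intro add_mono mult_mono) (auto simp: abs_square_le_1)
  finally show ?thesis by (simp add: algebra_simps)
qed

text \<open>
  The set where \<open>\<eta>\<close> does not vanish is open and nonempty, so it contains a point \<open>x0\<close> other than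
  the origin, and by continuity the phase of \<open>\<eta>\<close> hardly varies near \<open>x0\<close>.
\<close>

lemma ex_curve_piece:
  fixes \<phi> :: "real \<Rightarrow> real" and \<eta> :: "real \<Rightarrow> complex"
  assumes \<delta>: "\<delta> \<le> 1" and d: "d \<noteq> 0"
    and near: "\<And>x y. x \<in> I \<inter> {-\<delta><..<\<delta>} \<Longrightarrow> y \<in> I \<inter> {-\<delta><..<\<delta>} \<Longrightarrow>
      \<bar>\<phi> x - \<phi> y - d * (x - y)\<bar> \<le> \<bar>d\<bar> / 2 * \<bar>x - y\<bar>"
    and \<eta>: "C0inf \<eta>" "\<eta> z \<noteq> 0" "supp \<eta> \<subseteq> I \<inter> {-\<delta><..<\<delta>}"
  obtains x0 r c \<Lambda> w where "curve_piece \<phi> \<eta> x0 r c \<Lambda> w"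
proof -
  define A where "A = I \<inter> {-\<delta><..<\<delta>}"
  have sub: "{x. \<eta> x \<noteq> 0} \<subseteq> A"
    using \<eta>(3) closure_subset[of "{x. \<eta> x \<noteq> 0}"] unfolding supp_def A_def by (rule order.trans[rotated])
  have \<eta>c: "continuous_on UNIV \<eta>"
    using \<eta>(1) Ck_on.simps(1) unfolding C0inf_def Cinf_on_def by blast
  have op: "open {x. \<eta> x \<noteq> 0}"
    by (intro open_Collect_neq \<eta>c continuous_on_const)
  have "\<not> {x. \<eta> x \<noteq> 0} \<subseteq> {0}"
  proof
    assume "{x. \<eta> x \<noteq> 0} \<subseteq> {0}"
    with \<eta>(2) have "{x. \<eta> x \<noteq> 0} = {0}" by auto
    with op show False using not_open_singleton[of "0::real"] by simp
  qed
  then obtain x0 where x0: "\<eta> x0 \<noteq> 0" "x0 \<noteq> 0" by blast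
  define w where "w = cnj (\<eta> x0) / norm (\<eta> x0)"
  define c where "c = norm (\<eta> x0) / 2"
  have c: "c > 0" using x0 by (simp add: c_def)
  have "isCont \<eta> x0"
    using \<eta>c by (simp add: continuous_on_eq_continuous_at)
  then have "((\<lambda>x. Re (w * \<eta> x)) \<longlongrightarrow> Re (w * \<eta> x0)) (nhds x0)"
    unfolding isCont_def tendsto_at_iff_tendsto_nhds by (intro tendsto_intros)
  moreover have "Re (w * \<eta> x0) = 2 * c"
    using x0 by (simp add: w_def c_def complex_norm_square[symmetric] mult.commute power2_eq_square)
  ultimately have "eventually (\<lambda>x. c < Re (w * \<eta> x)) (nhds x0)"
    using c by (intro order_tendstoD(1)) auto
  then obtain e where e: "e > 0" "\<And>x. dist x x0 < e \<Longrightarrow> c < Re (w * \<eta> x)"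
    unfolding eventually_nhds_metric by blast
  define r where "r = min (e / 2) (\<bar>x0\<bar> / 4)"
  have r: "0 < r" "r \<le> \<bar>x0\<bar> / 4" using e x0 by (auto simp: r_def)
  let ?J = "{x0 - r..x0 + r}"
  have ge: "c < Re (w * \<eta> x)" if "x \<in> ?J" for x
  proof (rule e(2))
    have "\<bar>x - x0\<bar> \<le> r" using that by (auto simp: abs_le_iff)
    also have "r < e" using e by (auto simp: r_def min_def)
    finally show "dist x x0 < e" by (simp add: dist_real_def)
  qed
  have JA: "x \<in> A" if "x \<in> ?J" for x
    using ge[OF that] c sub by fastforce
  have near': "\<bar>\<phi> x - \<phi> y - d * (x - y)\<bar> \<le> \<bar>d\<bar> / 2 * \<bar>x - y\<bar>" if "x \<in> A" "y \<in> A" for x y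
    using near that by (simp add: A_def)
  define L where "L = 3 / 2 * \<bar>d\<bar>"
  have lip: "\<bar>\<phi> x - \<phi> y\<bar> \<le> L * \<bar>x - y\<bar>" if "x \<in> A" "y \<in> A" for x y
  proof -
    have "\<bar>\<phi> x - \<phi> y\<bar> \<le> \<bar>\<phi> x - \<phi> y - d * (x - y)\<bar> + \<bar>d * (x - y)\<bar>" by simp
    also have "\<dots> \<le> L * \<bar>x - y\<bar>"
      using near'[OF that] by (simp add: L_def abs_mult)
    finally show ?thesis .
  qed
  have A1: "\<bar>x\<bar> \<le> 1" if "x \<in> A" for x
    using that \<delta> by (auto simp: A_def)
  define B where "B = \<bar>\<phi> x0\<bar> + 2 * L"
  have L0: "0 \<le> L" by (simp add: L_def)
  have x0A: "x0 \<in> A" using JA[of x0] r by simp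
  have B: "\<bar>\<phi> y\<bar> \<le> B" if "y \<in> A" for y
  proof -
    have "L * \<bar>y - x0\<bar> \<le> L * 2"
      using A1[OF that] A1[OF x0A] L0 by (intro mult_left_mono) auto
    with lip[OF that x0A] show ?thesis by (simp add: B_def)
  qed
  define \<Lambda> where "\<Lambda> = max 1 (L + 2 * B)"
  have "curve_piece \<phi> \<eta> x0 r c \<Lambda> w"
  proof
    show "norm w \<le> 1" using x0 by (simp add: w_def norm_divide)
    show "continuous_on ?J \<eta>" using \<eta>c continuous_on_subset by blast
    show "\<bar>x\<bar> \<le> 1" if "\<eta> x \<noteq> 0" for x using that sub A1 by blast
    show "continuous_on ?J \<phi>"
    proof -
      have "L-lipschitz_on ?J \<phi>"
        using lip JA L0 by (intro lipschitz_onI) (auto simp: dist_real_def)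
      then show ?thesis by (rule lipschitz_on_continuous_on)
    qed
    show "inj_on \<phi> ?J"
    proof (rule inj_onI)
      fix x y assume xy: "x \<in> ?J" "y \<in> ?J" "\<phi> x = \<phi> y"
      then have "\<bar>d\<bar> * \<bar>x - y\<bar> \<le> \<bar>d\<bar> / 2 * \<bar>x - y\<bar>"
        using near'[OF JA[OF xy(1)] JA[OF xy(2)]] by (simp add: abs_mult)
      then have "\<bar>d\<bar> * \<bar>x - y\<bar> \<le> 0" by simp
      with d show "x = y" by (simp add: mult_le_0_iff)
    qed
    show "\<bar>x\<^sup>2 * \<phi> x - y\<^sup>2 * \<phi> y\<bar> \<le> \<Lambda> * \<bar>x - y\<bar>" if "x \<in> ?J" "y \<in> ?J" for x y
    proof -
      have "\<bar>x\<^sup>2 * \<phi> x - y\<^sup>2 * \<phi> y\<bar> \<le> (L + 2 * B) * \<bar>x - y\<bar>"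
        using JA[OF that(1)] JA[OF that(2)] by (intro square_mult_lipschitz A1 B lip)
      also have "\<dots> \<le> \<Lambda> * \<bar>x - y\<bar>" by (intro mult_right_mono) (auto simp: \<Lambda>_def)
      finally show ?thesis .
    qed
  qed (use r c ge in \<open>auto simp: \<Lambda>_def less_imp_le\<close>)
  then show ?thesis by (rule that)
qed

lemma ereal_one_divide: "1 \<le> p \<Longrightarrow> 1 / p = ereal (1 / real_of_ereal p)"
  by (cases p) (auto simp: one_ereal_def)

theorem theorem4p1:
  fixes I :: "real set" and \<phi> :: "real \<Rightarrow> real"
  assumes "is_interval I" and "bounded I" and "interior I \<noteq> {}" and "0 \<in> I"
    and "Cinf_on \<phi> I"
    and "\<phi> 0 \<noteq> 0"
    and "vector_derivative \<phi> (at 0 within I) \<noteq> 0"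
  shows "\<exists>\<delta>>0. \<forall>\<eta>::real \<Rightarrow> complex.
    C0inf \<eta> \<and> (\<exists>x. \<eta> x \<noteq> 0) \<and> supp \<eta> \<subseteq> I \<inter> {-\<delta><..<\<delta>} \<longrightarrow>
    (\<forall>p q :: ereal. 1 \<le> p \<and> 1 \<le> q \<and>
      (\<exists>C\<ge>0. \<forall>f::real \<times> real \<Rightarrow> complex. C0inf f \<longrightarrow>
        Lp_norm q lborel (maximal_fun \<phi> \<eta> f)
          \<le> ennreal C * Lp_norm p lborel (\<lambda>y. ennreal (norm (f y)))) \<longrightarrow>
      1 / q \<le> 1 / p \<and> 1 / q \<ge> 1 / (2 * p) \<and> 1 / q \<ge> 2 / p - 1)"
proof -
  obtain \<delta> d where \<delta>: "0 < \<delta>" "\<delta> \<le> 1" and d: "d \<noteq> 0"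
    and near: "\<And>x y. x \<in> I \<inter> {-\<delta><..<\<delta>} \<Longrightarrow> y \<in> I \<inter> {-\<delta><..<\<delta>} \<Longrightarrow>
      \<bar>\<phi> x - \<phi> y - d * (x - y)\<bar> \<le> \<bar>d\<bar> / 2 * \<bar>x - y\<bar>"
    by (rule near_linear_of_nonzero_derivative[OF assms(1,3,4,5,7)]) blast
  show ?thesis
  proof (intro exI[of _ \<delta>] conjI \<delta>(1) allI impI; elim conjE exE)
    fix \<eta> :: "real \<Rightarrow> complex" and p q :: ereal and z C
    assume \<eta>: "C0inf \<eta>" "\<eta> z \<noteq> 0" "supp \<eta> \<subseteq> I \<inter> {-\<delta><..<\<delta>}" and pq: "1 \<le> p" "1 \<le> q"
      and C: "C \<ge> 0" and bound: "\<forall>f::real \<times> real \<Rightarrow> complex. C0inf f \<longrightarrow>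
        Lp_norm q lborel (maximal_fun \<phi> \<eta> f)
          \<le> ennreal C * Lp_norm p lborel (\<lambda>y. ennreal (norm (f y)))"
    obtain x0 r c \<Lambda> w where "curve_piece \<phi> \<eta> x0 r c \<Lambda> w"
      by (rule ex_curve_piece[OF \<delta>(2) d near \<eta>])
    then interpret curve_piece \<phi> \<eta> x0 r c \<Lambda> w .
    note cond = exponent_conditions[OF pq C bound]
    have a: "0 \<le> 1 / real_of_ereal q"
      using pq(2) by (cases q) auto
    have q: "1 / q = ereal (1 / real_of_ereal q)" using pq(2) by (rule ereal_one_divide)
    have p: "1 / p = ereal (1 / real_of_ereal p)" using pq(1) by (rule ereal_one_divide)
    have p2: "1 / (2 * p) = ereal (1 / real_of_ereal p / 2)" "2 / p = ereal (2 * (1 / real_of_ereal p))"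
      using pq(1) by (cases p; auto simp: one_ereal_def numeral_eq_ereal)+
    show "1 / q \<le> 1 / p" using cond(1) unfolding q p by simp
    show "1 / (2 * p) \<le> 1 / q" using cond(2) unfolding q p2 by simp
    have "2 / p - 1 = ereal (2 * (1 / real_of_ereal p) - 1)"
      by (simp only: p2 one_ereal_def ereal_minus)
    moreover have "2 * (1 / real_of_ereal p) - 1 \<le> 1 / real_of_ereal q"
      using cond(3) a by linarith
    ultimately show "2 / p - 1 \<le> 1 / q"
      by (simp add: q)
  qed
qed

end
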